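(* $G^{\mathrm{Pink}}_{3,2,\infty}=\tilde B_{3,2,\infty}$.
   Context: $T_\infty$ is the infinite binary rooted tree whose nodes are finite words in $\{a,b\}$ (root = empty word, $w$ joined to $wa,wb$), with automorphism group $\mathrm{Aut}(T_\infty)$ (profinite topology). For $\sigma\in\mathrm{Aut}(T_\infty)$ and a word $x$, $\mathrm{Par}(\sigma,x)\in\mathbb{Z}/2\mathbb{Z}$ is $0$ if $\sigma(xa)=\sigma(x)a$ and $1$ if $\sigma(xa)=\sigma(x)b$. Define $P^a_{3,2}(\sigma,x)=\sum_{w\in\{a,b\}^2}\mathrm{Par}(\sigma,xaw)+\sum_{w'\in\{a,b\}}\mathrm{Par}(\sigma,xbw')$ and $P^b_{3,2}(\sigma,x)=\sum_{w\in\{a,b\}^2}\mathrm{Par}(\sigma,xbw)+\sum_{w'\in\{a,b\}}\mathrm{Par}(\sigma,xaw')$; $M_{3,2,\infty}$ is the set of $\sigma$ for which all these values (over all nodes $x$) coincide, with common value $P_{3,2}(\sigma)$, and $B_{3,2,\infty}=\{\sigma\in M_{3,2,\infty}:P_{3,2}(\sigma)=0\}$. Define $R_{3,2}(\sigma,x)=\sum_{w\in\{a,b\}^2}\big[\mathrm{Par}(\sigma,xw)+\mathrm{Par}(\sigma,xwb)+\sum_{t\in\{a,b\}}\mathrm{Par}(\sigma,xwat)\big]+[\mathrm{Par}(\sigma,xaa)+\mathrm{Par}(\sigma,xab)][\mathrm{Par}(\sigma,xba)+\mathrm{Par}(\sigma,xbb)]\in\mathbb{Z}/2\mathbb{Z}$.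 $\tilde M_{3,2,\infty}$ is the set of $\sigma\in M_{3,2,\infty}$ with $R_{3,2}(\sigma,x)$ independent of $x$ (common value $R_{3,2}(\sigma)$), and $\tilde B_{3,2,\infty}=\{\sigma\in\tilde M_{3,2,\infty}\cap B_{3,2,\infty}:R_{3,2}(\sigma)=0\}$. Pink's group: $G^{\mathrm{Pink}}_{3,2,\infty}$ is the closure of the subgroup generated by $\alpha_1,\alpha_2,\alpha_3\in\mathrm{Aut}(T_\infty)$, where $\mathrm{Par}(\alpha_1,x)=1$ iff $x$ is the root, $\mathrm{Par}(\alpha_2,x)=1$ iff $x=a$, and $\mathrm{Par}(\alpha_3,w)=1$ iff $w=b^naa$ for some $n\ge0$ (equivalently $\alpha_1=\tau$, $\alpha_2=(\tau,1)$, $\alpha_3=(\alpha_2,\alpha_3)$, where $(\alpha,\beta)$ acts as $\alpha$ on the subtree above $a$ and as $\beta$ on that above $b$, fixing $a$ and $b$). *)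

theory Defs
  imports "HOL-Analysis.Analysis" "HOL-Algebra.Bij" "HOL-Algebra.Generated_Groups" "HOL-Library.Z2"
begin

datatype letter = La | Lb

type_synonym node = "letter list"

text \<open>The node \<open>w\<close> is joined to its two children \<open>w @ [La]\<close> and \<open>w @ [Lb]\<close>.\<close>

definition tree_adj :: "node \<Rightarrow> node \<Rightarrow> bool" where
  "tree_adj u v \<longleftrightarrow> (\<exists>y. v = u @ [y]) \<or> (\<exists>y. u = v @ [y])"

text \<open>Automorphisms of the rooted tree induced on a set \<open>V\<close> of nodes. The case \<open>V = UNIV\<close>
  is the infinite tree; \<open>V = level_nodes n\<close> is the finite tree of height \<open>n\<close>.\<close>

definition tree_aut :: "node set \<Rightarrow> (node \<Rightarrow> node) set" where
  "tree_aut V = {\<sigma> \<in> Bij V. \<sigma> [] = [] \<and> (\<forall>u\<in>V. \<forall>v\<in>V. tree_adj (\<sigma> u) (\<sigma> v) \<longleftrightarrow> tree_adj u v)}"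

definition level_nodes :: "nat \<Rightarrow> node set" where
  "level_nodes n = {w. length w \<le> n}"

abbreviation Aut_T :: "(node \<Rightarrow> node) set" where
  "Aut_T \<equiv> tree_aut UNIV"

definition Aut_T_group :: "(node \<Rightarrow> node) monoid" where
  "Aut_T_group = (BijGroup UNIV)\<lparr>carrier := Aut_T\<rparr>"

text \<open>The profinite topology is the inverse limit topology: the initial topology for the map into
  the product of the discrete groups of automorphisms of the finite trees.\<close>

definition Aut_T_topology :: "(node \<Rightarrow> node) topology" where
  "Aut_T_topology = pullback_topology Aut_T (\<lambda>\<sigma> n. restrict \<sigma> (level_nodes n))
     (product_topology (\<lambda>n. discrete_topology (tree_aut (level_nodes n))) UNIV)"

definition Par :: "(node \<Rightarrow> node) \<Rightarrow> node \<Rightarrow> bit" where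
  "Par \<sigma> x = (if \<sigma> (x @ [La]) = \<sigma> x @ [La] then 0 else 1)"

definition words2 :: "node set" where
  "words2 = {w. length w = 2}"

definition Pa32 :: "(node \<Rightarrow> node) \<Rightarrow> node \<Rightarrow> bit" where
  "Pa32 \<sigma> x = (\<Sum>w\<in>words2. Par \<sigma> (x @ [La] @ w)) + (\<Sum>y\<in>{La, Lb}. Par \<sigma> (x @ [Lb] @ [y]))"

definition Pb32 :: "(node \<Rightarrow> node) \<Rightarrow> node \<Rightarrow> bit" where
  "Pb32 \<sigma> x = (\<Sum>w\<in>words2. Par \<sigma> (x @ [Lb] @ w)) + (\<Sum>y\<in>{La, Lb}. Par \<sigma> (x @ [La] @ [y]))"

definition M32 :: "(node \<Rightarrow> node) set" where
  "M32 = {\<sigma> \<in> Aut_T. \<exists>c. \<forall>x. Pa32 \<sigma> x = c \<and> Pb32 \<sigma> x = c}"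

definition P32 :: "(node \<Rightarrow> node) \<Rightarrow> bit" where
  "P32 \<sigma> = (THE c. \<forall>x. Pa32 \<sigma> x = c \<and> Pb32 \<sigma> x = c)"

definition B32 :: "(node \<Rightarrow> node) set" where
  "B32 = {\<sigma> \<in> M32. P32 \<sigma> = 0}"

definition R32_at :: "(node \<Rightarrow> node) \<Rightarrow> node \<Rightarrow> bit" where
  "R32_at \<sigma> x =
     (\<Sum>w\<in>words2. Par \<sigma> (x @ w) + Par \<sigma> (x @ w @ [Lb]) + (\<Sum>t\<in>{La, Lb}. Par \<sigma> (x @ w @ [La] @ [t])))
     + (Par \<sigma> (x @ [La, La]) + Par \<sigma> (x @ [La, Lb])) * (Par \<sigma> (x @ [Lb, La]) + Par \<sigma> (x @ [Lb, Lb]))"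

definition M32_tilde :: "(node \<Rightarrow> node) set" where
  "M32_tilde = {\<sigma> \<in> M32. \<exists>c. \<forall>x. R32_at \<sigma> x = c}"

definition R32 :: "(node \<Rightarrow> node) \<Rightarrow> bit" where
  "R32 \<sigma> = (THE c. \<forall>x. R32_at \<sigma> x = c)"

definition B32_tilde :: "(node \<Rightarrow> node) set" where
  "B32_tilde = {\<sigma> \<in> M32_tilde \<inter> B32. R32 \<sigma> = 0}"

fun flip :: "letter \<Rightarrow> letter" where
  "flip La = Lb"
| "flip Lb = La"

text \<open>The automorphism with prescribed parities \<open>p\<close>; see \<open>aut_of_par_in_Aut_T\<close>,
  \<open>Par_aut_of_par\<close> and \<open>aut_of_par_Par\<close> below.\<close>

fun aut_of_par :: "(node \<Rightarrow> bit) \<Rightarrow> node \<Rightarrow> node" where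
  "aut_of_par p [] = []"
| "aut_of_par p (y # w) = (if p [] = 1 then flip y else y) # aut_of_par (\<lambda>v. p (y # v)) w"

definition alpha1 :: "node \<Rightarrow> node" where
  "alpha1 = aut_of_par (\<lambda>x. of_bool (x = []))"

definition alpha2 :: "node \<Rightarrow> node" where
  "alpha2 = aut_of_par (\<lambda>x. of_bool (x = [La]))"

definition alpha3 :: "node \<Rightarrow> node" where
  "alpha3 = aut_of_par (\<lambda>x. of_bool (\<exists>n. x = replicate n Lb @ [La, La]))"

definition G32_Pink :: "(node \<Rightarrow> node) set" where
  "G32_Pink = Aut_T_topology closure_of (generate Aut_T_group {alpha1, alpha2, alpha3})"


lemma words2_eq: "words2 = {[La, La], [La, Lb], [Lb, La], [Lb, Lb]}"
proof -
  have "w \<in> words2 \<longleftrightarrow> w \<in> {[La, La], [La, Lb], [Lb, La], [Lb, Lb]}" for w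
  proof (cases "length w = 2")
    case True
    then obtain u v where "w = [u, v]"
      by (auto simp: numeral_2_eq_2 length_Suc_conv)
    then show ?thesis by (cases u; cases v) (auto simp: words2_def)
  qed (auto simp: words2_def)
  then show ?thesis by blast
qed

lemma tree_aut_subgroup: "[] \<in> V \<Longrightarrow> subgroup (tree_aut V) (BijGroup V)"
proof -
  assume V: "[] \<in> V"
  interpret group "BijGroup V" by (rule group_BijGroup)
  show ?thesis
  proof (rule subgroupI)
    show "tree_aut V \<subseteq> carrier (BijGroup V)" by (auto simp: tree_aut_def BijGroup_def)
    have "(\<lambda>x\<in>V. x) \<in> tree_aut V"
      using V id_Bij[of V] by (auto simp: tree_aut_def)
    then show "tree_aut V \<noteq> {}" by blast
  next
    fix f assume "f \<in> tree_aut V"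
    then have f: "f \<in> Bij V" "f [] = []"
      "\<And>u v. u \<in> V \<Longrightarrow> v \<in> V \<Longrightarrow> tree_adj (f u) (f v) \<longleftrightarrow> tree_adj u v"
      by (auto simp: tree_aut_def)
    have bij: "bij_betw f V V" using f(1) by (simp add: Bij_def)
    let ?g = "restrict (inv_into V f) V"
    have g: "inv\<^bsub>BijGroup V\<^esub> f = ?g" using f(1) by (simp add: inv_BijGroup)
    have "?g \<in> Bij V" using f(1) by (rule restrict_inv_into_Bij)
    moreover have "?g [] = []"
      using V f(2) bij by (metis bij_betw_inv_into_left restrict_apply')
    moreover have "tree_adj (?g u) (?g v) \<longleftrightarrow> tree_adj u v" if "u \<in> V" "v \<in> V" for u v
    proof -
      have "?g u \<in> V" "?g v \<in> V" "f (?g u) = u" "f (?g v) = v"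
        using that bij bij_betw_inv_into_right[OF bij] bij_betw_inv_into[OF bij]
        by (auto dest: bij_betwE)
      then show ?thesis using f(3) by metis
    qed
    ultimately show "inv\<^bsub>BijGroup V\<^esub> f \<in> tree_aut V" by (simp add: g tree_aut_def)
  next
    fix f g assume "f \<in> tree_aut V" "g \<in> tree_aut V"
    then have fg: "f \<in> Bij V" "g \<in> Bij V" "f [] = []" "g [] = []"
      "\<And>u v. u \<in> V \<Longrightarrow> v \<in> V \<Longrightarrow> tree_adj (f u) (f v) \<longleftrightarrow> tree_adj u v"
      "\<And>u v. u \<in> V \<Longrightarrow> v \<in> V \<Longrightarrow> tree_adj (g u) (g v) \<longleftrightarrow> tree_adj u v"
      by (auto simp: tree_aut_def)
    have "g u \<in> V" if "u \<in> V" for u using fg(2) that by (auto simp: Bij_def dest: bij_betwE)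
    then show "f \<otimes>\<^bsub>BijGroup V\<^esub> g \<in> tree_aut V"
      using fg V compose_Bij[OF fg(1,2)] by (auto simp: tree_aut_def BijGroup_def compose_def)
  qed
qed

lemma Aut_T_group_group: "group Aut_T_group"
  unfolding Aut_T_group_def
  by (rule subgroup.subgroup_is_group[OF tree_aut_subgroup group_BijGroup]) simp

lemma flip_flip [simp]: "flip (flip y) = y" by (cases y) auto

lemma flip_neq [simp]: "flip y \<noteq> y" "y \<noteq> flip y" by (cases y; simp)+

lemma flip_eq_iff [simp]: "flip x = flip y \<longleftrightarrow> x = y" by (metis flip_flip)

lemma flip_unique: "x \<noteq> y \<Longrightarrow> x = flip y" by (cases x; cases y) auto

lemma aut_of_par_snoc:
  "aut_of_par p (x @ [y]) = aut_of_par p x @ [if p x = 1 then flip y else y]"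
  by (induction x arbitrary: p) auto

lemma length_aut_of_par [simp]: "length (aut_of_par p x) = length x"
  by (induction x arbitrary: p) auto

lemma inj_aut_of_par: "aut_of_par p x = aut_of_par p y \<Longrightarrow> x = y"
proof (induction x arbitrary: p y)
  case Nil
  then show ?case by (metis length_aut_of_par length_0_conv)
next
  case (Cons u x)
  then show ?case by (cases y) (auto split: if_splits)
qed

lemma surj_aut_of_par: "\<exists>x. aut_of_par p x = y"
proof (induction y arbitrary: p)
  case Nil
  then show ?case by (metis aut_of_par.simps(1))
next
  case (Cons u y)
  let ?u = "if p [] = 1 then flip u else u"
  obtain x where "aut_of_par (\<lambda>v. p (?u # v)) x = y" using Cons by blast
  then have "aut_of_par p (?u # x) = u # y" by auto
  then show ?case by blast
qed

lemma aut_of_par_in_Aut_T: "aut_of_par p \<in> Aut_T"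
proof -
  have child: "(\<exists>y. aut_of_par p v = aut_of_par p u @ [y]) \<longleftrightarrow> (\<exists>y. v = u @ [y])" for u v
  proof
    assume "\<exists>y. aut_of_par p v = aut_of_par p u @ [y]"
    then obtain y where y: "aut_of_par p v = aut_of_par p u @ [y]" by blast
    have "aut_of_par p (u @ [if p u = 1 then flip y else y]) = aut_of_par p u @ [y]"
      by (simp add: aut_of_par_snoc)
    with y have "v = u @ [if p u = 1 then flip y else y]" by (metis inj_aut_of_par)
    then show "\<exists>y. v = u @ [y]" by blast
  qed (auto simp: aut_of_par_snoc)
  have "bij (aut_of_par p)"
    by (metis bijI injI surjI surj_def inj_aut_of_par surj_aut_of_par)
  then show ?thesis
    by (auto simp: tree_aut_def Bij_def tree_adj_def child)
qed

lemma Par_aut_of_par: "Par (aut_of_par p) x = p x"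
  by (cases "p x") (auto simp: Par_def aut_of_par_snoc)

text \<open>Conversely, an automorphism is determined by its parities.\<close>

lemma Aut_T_length: "\<sigma> \<in> Aut_T \<Longrightarrow> length (\<sigma> x) = length x"
  and Aut_T_child: "\<sigma> \<in> Aut_T \<Longrightarrow> \<exists>z. \<sigma> (x @ [y]) = \<sigma> x @ [z]"
proof -
  assume \<sigma>: "\<sigma> \<in> Aut_T"
  then have inj: "inj \<sigma>" and root: "\<sigma> [] = []"
    and adj: "\<And>u v. tree_adj (\<sigma> u) (\<sigma> v) \<longleftrightarrow> tree_adj u v"
    by (auto simp: tree_aut_def Bij_def bij_betw_def)
  have child: "\<exists>z. \<sigma> (x @ [y]) = \<sigma> x @ [z]" for x y
  proof (induction x arbitrary: y rule: rev_induct)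
    case Nil
    have "tree_adj (\<sigma> []) (\<sigma> [y])" unfolding adj by (auto simp: tree_adj_def)
    then show ?case by (auto simp: root tree_adj_def)
  next
    case (snoc u x)
    obtain z where z: "\<sigma> (x @ [u]) = \<sigma> x @ [z]" using snoc by blast
    have "tree_adj (\<sigma> (x @ [u])) (\<sigma> (x @ [u, y]))" unfolding adj by (auto simp: tree_adj_def)
    moreover have "\<sigma> (x @ [u, y]) \<noteq> \<sigma> x" using inj by (auto dest: injD)
    ultimately show ?case by (auto simp: tree_adj_def z)
  qed
  show "\<exists>z. \<sigma> (x @ [y]) = \<sigma> x @ [z]" by (rule child)
  show "length (\<sigma> x) = length x"
  proof (induction x rule: rev_induct)
    case (snoc y x)
    then show ?case using child[of x y] by auto
  qed (simp add: root)
qed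

lemma Aut_T_snoc:
  assumes \<sigma>: "\<sigma> \<in> Aut_T"
  shows "\<sigma> (x @ [y]) = \<sigma> x @ [if Par \<sigma> x = 1 then flip y else y]"
proof -
  obtain za zb where z: "\<sigma> (x @ [La]) = \<sigma> x @ [za]" "\<sigma> (x @ [Lb]) = \<sigma> x @ [zb]"
    using Aut_T_child[OF \<sigma>] by metis
  have "inj \<sigma>" using \<sigma> by (auto simp: tree_aut_def Bij_def bij_betw_def)
  then have "za \<noteq> zb" using z by (metis injD same_append_eq list.inject letter.distinct(1))
  then show ?thesis using z by (cases y; cases za; cases zb) (auto simp: Par_def)
qed

lemma aut_of_par_Par: "\<sigma> \<in> Aut_T \<Longrightarrow> aut_of_par (Par \<sigma>) = \<sigma>"
proof
  fix x assume \<sigma>: "\<sigma> \<in> Aut_T"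
  then have root: "\<sigma> [] = []" by (simp add: tree_aut_def)
  show "aut_of_par (Par \<sigma>) x = \<sigma> x"
    by (induction x rule: rev_induct) (auto simp: root aut_of_par_snoc Aut_T_snoc[OF \<sigma>])
qed

lemma Aut_T_restrict:
  assumes \<sigma>: "\<sigma> \<in> Aut_T"
  shows "restrict \<sigma> (level_nodes n) \<in> tree_aut (level_nodes n)"
proof -
  have b: "bij \<sigma>" using \<sigma> by (simp add: tree_aut_def Bij_def)
  have "bij_betw (restrict \<sigma> (level_nodes n)) (level_nodes n) (level_nodes n)"
  proof -
    have "\<sigma> ` level_nodes n = level_nodes n"
    proof
      show "level_nodes n \<subseteq> \<sigma> ` level_nodes n"
      proof
        fix w assume w: "w \<in> level_nodes n"
        obtain v where v: "w = \<sigma> v" using b by (metis bij_pointE)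
        then show "w \<in> \<sigma> ` level_nodes n"
          using w Aut_T_length[OF \<sigma>, of v] by (auto simp: level_nodes_def)
      qed
    qed (auto simp: level_nodes_def Aut_T_length[OF \<sigma>])
    then show ?thesis
      using b by (auto simp: bij_betw_def inj_on_def)
  qed
  then show ?thesis using \<sigma> by (auto simp: tree_aut_def Bij_def level_nodes_def)
qed

lemma topspace_Aut_T_topology: "topspace Aut_T_topology = Aut_T"
  unfolding Aut_T_topology_def topspace_pullback_topology
  using Aut_T_restrict by auto

lemma Aut_T_closure:
  assumes S: "S \<subseteq> Aut_T"
  shows "Aut_T_topology closure_of S =
    {\<sigma> \<in> Aut_T. \<forall>n. \<exists>\<tau>\<in>S. \<forall>w. length w \<le> n \<longrightarrow> \<tau> w = \<sigma> w}"
proof -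
  let ?r = "\<lambda>\<sigma> n. restrict \<sigma> (level_nodes n) :: node \<Rightarrow> node"
  let ?X = "product_topology (\<lambda>n. discrete_topology (tree_aut (level_nodes n))) UNIV"
  have req: "?r \<tau> n = ?r \<sigma> n \<longleftrightarrow> (\<forall>w. length w \<le> n \<longrightarrow> \<tau> w = \<sigma> w)" for \<sigma> \<tau> n
    by (auto simp: level_nodes_def fun_eq_iff restrict_def)
  have nbhd: "\<exists>U. openin Aut_T_topology U \<and> \<sigma> \<in> U \<and>
      (\<forall>\<tau>\<in>U. \<forall>w. length w \<le> n \<longrightarrow> \<tau> w = \<sigma> w)" if \<sigma>: "\<sigma> \<in> Aut_T" for \<sigma> n
  proof -
    let ?U = "{f \<in> topspace ?X. f n \<in> {?r \<sigma> n}}"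
    have "openin ?X ?U"
      by (rule openin_continuous_map_preimage[OF continuous_map_product_projection])
        (use Aut_T_restrict[OF \<sigma>] in auto)
    then have "openin Aut_T_topology (?r -` ?U \<inter> Aut_T)"
      unfolding Aut_T_topology_def openin_pullback_topology by blast
    then show ?thesis using \<sigma> Aut_T_restrict req
      by (intro exI[of _ "?r -` ?U \<inter> Aut_T"]) auto
  qed
  have basic: "\<exists>n. \<forall>\<tau>\<in>Aut_T. (\<forall>w. length w \<le> n \<longrightarrow> \<tau> w = \<sigma> w) \<longrightarrow> \<tau> \<in> U"
    if U: "openin Aut_T_topology U" "\<sigma> \<in> U" for \<sigma> U
  proof -
    obtain W where W: "openin ?X W" "U = ?r -` W \<inter> Aut_T"
      using U(1) unfolding Aut_T_topology_def openin_pullback_topology by blast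
    then obtain Y where Y: "finite {i. Y i \<noteq> tree_aut (level_nodes i)}" "?r \<sigma> \<in> Pi\<^sub>E UNIV Y" "Pi\<^sub>E UNIV Y \<subseteq> W"
      using U(2) by (fastforce simp: openin_product_topology_alt)
    obtain n where "\<forall>i\<in>{i. Y i \<noteq> tree_aut (level_nodes i)}. i \<le> n"
      using Y(1) unfolding finite_nat_set_iff_bounded_le by blast
    then have n: "\<And>i. Y i \<noteq> tree_aut (level_nodes i) \<Longrightarrow> i \<le> n" by blast
    have "\<tau> \<in> U" if \<tau>: "\<tau> \<in> Aut_T" "\<forall>w. length w \<le> n \<longrightarrow> \<tau> w = \<sigma> w" for \<tau>
    proof -
      have "?r \<tau> i \<in> Y i" for i
      proof (cases "i \<le> n")
        case True
        then have "?r \<tau> i = ?r \<sigma> i" using \<tau>(2) by (subst req) auto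
        then show ?thesis using Y(2) by (auto simp: PiE_def Pi_def)
      next
        case False
        then show ?thesis using n Aut_T_restrict[OF \<tau>(1)] by blast
      qed
      then have "?r \<tau> \<in> Pi\<^sub>E UNIV Y" by auto
      then show ?thesis using W Y \<tau> by auto
    qed
    then show ?thesis by blast
  qed
  show ?thesis
  proof (intro subset_antisym subsetI)
    fix \<sigma> assume \<sigma>: "\<sigma> \<in> Aut_T_topology closure_of S"
    then have "\<sigma> \<in> Aut_T" by (simp add: in_closure_of topspace_Aut_T_topology)
    moreover have "\<exists>\<tau>\<in>S. \<forall>w. length w \<le> n \<longrightarrow> \<tau> w = \<sigma> w" for n
    proof -
      obtain U where U: "openin Aut_T_topology U" "\<sigma> \<in> U"
        "\<forall>\<tau>\<in>U. \<forall>w. length w \<le> n \<longrightarrow> \<tau> w = \<sigma> w"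
        using nbhd[OF \<open>\<sigma> \<in> Aut_T\<close>] by blast
      obtain \<tau> where "\<tau> \<in> S" "\<tau> \<in> U" using \<sigma> U(1,2) unfolding in_closure_of by blast
      then show ?thesis using U(3) by blast
    qed
    ultimately show "\<sigma> \<in> {\<sigma> \<in> Aut_T. \<forall>n. \<exists>\<tau>\<in>S. \<forall>w. length w \<le> n \<longrightarrow> \<tau> w = \<sigma> w}"
      by blast
  next
    fix \<sigma> assume "\<sigma> \<in> {\<sigma> \<in> Aut_T. \<forall>n. \<exists>\<tau>\<in>S. \<forall>w. length w \<le> n \<longrightarrow> \<tau> w = \<sigma> w}"
    then have \<sigma>: "\<sigma> \<in> Aut_T" "\<And>n. \<exists>\<tau>\<in>S. \<forall>w. length w \<le> n \<longrightarrow> \<tau> w = \<sigma> w" by blast+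
    have "\<exists>\<tau>. \<tau> \<in> S \<and> \<tau> \<in> U" if U: "\<sigma> \<in> U" "openin Aut_T_topology U" for U
    proof -
      obtain n where n: "\<forall>\<tau>\<in>Aut_T. (\<forall>w. length w \<le> n \<longrightarrow> \<tau> w = \<sigma> w) \<longrightarrow> \<tau> \<in> U"
        using basic[OF U(2,1)] by blast
      obtain \<tau> where \<tau>: "\<tau> \<in> S" "\<forall>w. length w \<le> n \<longrightarrow> \<tau> w = \<sigma> w" using \<sigma>(2)[of n] by blast
      have "\<tau> \<in> Aut_T" using \<tau>(1) S by (rule subsetD[rotated])
      with n \<tau>(2) have "\<tau> \<in> U" by blast
      with \<tau>(1) show ?thesis by blast
    qed
    then show "\<sigma> \<in> Aut_T_topology closure_of S"
      unfolding in_closure_of topspace_Aut_T_topology using \<sigma>(1) by blast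
  qed
qed

lemma alpha_rec:
  "alpha1 (y # w) = flip y # w"
  "alpha2 (La # w) = La # alpha1 w" "alpha2 (Lb # w) = Lb # w"
  "alpha3 (La # w) = La # alpha2 w" "alpha3 (Lb # w) = Lb # alpha3 w"
proof -
  have triv: "aut_of_par (\<lambda>_. 0) w = w" for w by (induction w) auto
  have 1: "(\<exists>n. La # v = replicate n Lb @ [La, La]) \<longleftrightarrow> v = [La]" for v
  proof
    assume "\<exists>n. La # v = replicate n Lb @ [La, La]"
    then obtain n where "La # v = replicate n Lb @ [La, La]" by blast
    then show "v = [La]" by (cases n) auto
  qed (auto intro: exI[of _ 0])
  have 2: "(\<exists>n. Lb # v = replicate n Lb @ [La, La]) \<longleftrightarrow> (\<exists>n. v = replicate n Lb @ [La, La])" for v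
  proof
    assume "\<exists>n. Lb # v = replicate n Lb @ [La, La]"
    then obtain n where "Lb # v = replicate n Lb @ [La, La]" by blast
    then show "\<exists>n. v = replicate n Lb @ [La, La]" by (cases n) auto
  next
    assume "\<exists>n. v = replicate n Lb @ [La, La]"
    then show "\<exists>n. Lb # v = replicate n Lb @ [La, La]" by (metis append_Cons replicate_Suc)
  qed
  show "alpha1 (y # w) = flip y # w"
    "alpha2 (La # w) = La # alpha1 w" "alpha2 (Lb # w) = Lb # w"
    by (simp_all add: alpha1_def alpha2_def triv)
  show "alpha3 (La # w) = La # alpha2 w" "alpha3 (Lb # w) = Lb # alpha3 w"
    unfolding alpha3_def aut_of_par.simps 1 2 by (simp_all add: alpha2_def)
qed

end

theory Submission
  imports Defs
begin

text \<open>
  Write an automorphism as a pair of sections \<open>(g, h)\<close> followed by a possible swap of the two subtrees.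
  Membership in \<open>B32_tilde\<close> is then recursive: both sections lie in \<open>B32_tilde\<close> and satisfy
  \<open>lvl2 g = lvl1 h\<close>, \<open>lvl2 h = lvl1 g\<close>, \<open>quad2 g + quad2 h = lvl1 g * lvl1 h\<close>.
  On \<open>B32_tilde\<close> the first two functions are homomorphisms and
  \<open>quad2 (g \<circ> h) = quad2 g + quad2 h + lvl1 h * lvl2 g\<close>, so together they form a homomorphism onto the
  dihedral group of order 8, and the three equations say that the images of \<open>g\<close> and \<open>h\<close> correspond
  under the automorphism exchanging the images of \<open>alpha2\<close> and \<open>alpha3\<close>.
  Pink's discrete group obeys the same recursion: it contains \<open>(alpha1, 1)\<close>, \<open>(alpha2, alpha3)\<close> and
  their swaps, and modulo the normal closure of \<open>alpha1\<close> it is the dihedral group generated by \<open>alpha2\<close>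
  and \<open>alpha3\<close>, of order 8 since \<open>(alpha2 alpha3)^4 = 1\<close>. Hence a pair of elements of the discrete
  group belongs to it as soon as it lies in \<open>B32_tilde\<close>, and an element of \<open>B32_tilde\<close> is approximated
  level by level by approximating its sections.
\<close>

text \<open>The default rules rewrite bit sums and products to bitwise operations, which blocks ring
  normalisation.\<close>

declare add_bit_eq_xor [simp del] mult_bit_eq_and [simp del]

lemma bit_add_self [simp]: "(x::bit) + x = 0" "x + (x + y) = y"
  by (cases x; cases y; simp)+

lemma sum_words2: "(\<Sum>w\<in>words2. f w) = f [La, La] + f [La, Lb] + f [Lb, La] + (f [Lb, Lb] :: bit)"
  by (simp add: words2_eq add.assoc)

lemma sum_letters: "(\<Sum>y\<in>{La, Lb}. f y) = f La + (f Lb :: bit)"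
  by simp

section \<open>Sections and pairs of automorphisms\<close>

text \<open>The first letter of the image is dropped, so that the action on the subtree above
  \<open>y\<close> is again a map of the whole tree; that letter depends on the root parity
  alone.\<close>

definition sec :: "(node \<Rightarrow> node) \<Rightarrow> letter \<Rightarrow> node \<Rightarrow> node" where
  "sec \<sigma> y = (\<lambda>w. tl (\<sigma> (y # w)))"

definition pair :: "(node \<Rightarrow> node) \<Rightarrow> (node \<Rightarrow> node) \<Rightarrow> node \<Rightarrow> node" where
  "pair g h w = (case w of [] \<Rightarrow> [] | y # v \<Rightarrow> y # (if y = La then g else h) v)"

lemma Aut_T_root: "\<sigma> \<in> Aut_T \<Longrightarrow> \<sigma> [] = []"
  by (simp add: tree_aut_def)

lemma sec_aut_of_par: "sec (aut_of_par p) y = aut_of_par (\<lambda>v. p (y # v))"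
  by (auto simp: sec_def)

lemma sec_eq_aut_of_par: "\<sigma> \<in> Aut_T \<Longrightarrow> sec \<sigma> y = aut_of_par (\<lambda>v. Par \<sigma> (y # v))"
  using sec_aut_of_par[of "Par \<sigma>" y] by (simp add: aut_of_par_Par)

lemma sec_in_Aut_T: "\<sigma> \<in> Aut_T \<Longrightarrow> sec \<sigma> y \<in> Aut_T"
  by (simp add: sec_eq_aut_of_par aut_of_par_in_Aut_T)

lemma Par_sec: "\<sigma> \<in> Aut_T \<Longrightarrow> Par (sec \<sigma> y) w = Par \<sigma> (y # w)"
  by (simp add: sec_eq_aut_of_par Par_aut_of_par)

lemma Aut_T_Cons:
  assumes "\<sigma> \<in> Aut_T"
  shows "\<sigma> (y # w) = (if Par \<sigma> [] = 1 then flip y else y) # sec \<sigma> y w"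
proof -
  have "aut_of_par (Par \<sigma>) (y # w)
      = (if Par \<sigma> [] = 1 then flip y else y) # aut_of_par (\<lambda>v. Par \<sigma> (y # v)) w" by simp
  then show ?thesis by (simp only: aut_of_par_Par[OF assms] sec_eq_aut_of_par[OF assms, symmetric])
qed

lemma id_in_Aut_T: "id \<in> Aut_T"
  by (auto simp: tree_aut_def Bij_def)

lemma comp_in_Aut_T: "\<sigma> \<in> Aut_T \<Longrightarrow> \<tau> \<in> Aut_T \<Longrightarrow> \<sigma> \<circ> \<tau> \<in> Aut_T"
  by (auto simp: tree_aut_def Bij_def intro: bij_comp)

lemma Par_comp:
  assumes "\<sigma> \<in> Aut_T" "\<tau> \<in> Aut_T"
  shows "Par (\<sigma> \<circ> \<tau>) x = Par \<sigma> (\<tau> x) + Par \<tau> x"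
  by (cases "Par \<sigma> (\<tau> x)"; cases "Par \<tau> x")
    (simp_all add: Par_def[of "\<sigma> \<circ> \<tau>"] Aut_T_snoc[OF assms(1)] Aut_T_snoc[OF assms(2)])

lemma sec_comp:
  assumes "\<sigma> \<in> Aut_T" "\<tau> \<in> Aut_T"
  shows "sec (\<sigma> \<circ> \<tau>) y = sec \<sigma> (if Par \<tau> [] = 1 then flip y else y) \<circ> sec \<tau> y"
  by (rule ext) (simp add: sec_def[of "\<sigma> \<circ> \<tau>"] Aut_T_Cons[OF assms(1)] Aut_T_Cons[OF assms(2)])

lemma pair_in_Aut_T:
  assumes "g \<in> Aut_T" "h \<in> Aut_T"
  shows "pair g h \<in> Aut_T"
proof -
  have "pair g h = aut_of_par (\<lambda>w. case w of [] \<Rightarrow> 0 | y # v \<Rightarrow> if y = La then Par g v else Par h v)"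
    (is "_ = aut_of_par ?p")
  proof
    fix w show "pair g h w = aut_of_par ?p w"
      by (cases w) (auto simp: pair_def aut_of_par_Par assms)
  qed
  then show ?thesis by (simp add: aut_of_par_in_Aut_T)
qed

lemma Par_pair [simp]: "g [] = [] \<Longrightarrow> Par (pair g h) [] = 0"
  by (simp add: Par_def pair_def)

lemma sec_pair [simp]: "sec (pair g h) La = g" "sec (pair g h) Lb = h"
  by (auto simp: sec_def pair_def)

lemma pair_comp: "pair g h \<circ> pair g' h' = pair (g \<circ> g') (h \<circ> h')"
  by (auto simp: pair_def fun_eq_iff split: list.splits)

lemma pair_id: "pair id id = id"
  by (auto simp: pair_def fun_eq_iff split: list.splits)

section \<open>Level invariants and the recursive form of \<open>B32_tilde\<close>\<close>

definition lvl1 :: "(node \<Rightarrow> node) \<Rightarrow> bit" where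
  "lvl1 \<sigma> = Par \<sigma> [La] + Par \<sigma> [Lb]"

definition lvl2 :: "(node \<Rightarrow> node) \<Rightarrow> bit" where
  "lvl2 \<sigma> = Par \<sigma> [La, La] + Par \<sigma> [La, Lb] + Par \<sigma> [Lb, La] + Par \<sigma> [Lb, Lb]"

text \<open>Taken of the section at \<open>x @ w\<close> with \<open>w\<close> of length 2, this
  collects the terms of \<open>R32_at\<close> at depths 3 and 4 below \<open>x\<close>; the full sum
  over \<open>w\<close> then becomes \<open>quad2\<close> of the two sections at depth 1.\<close>

definition quad1 :: "(node \<Rightarrow> node) \<Rightarrow> bit" where
  "quad1 \<sigma> = Par \<sigma> [Lb] + Par \<sigma> [La, La] + Par \<sigma> [La, Lb]"

definition quad2 :: "(node \<Rightarrow> node) \<Rightarrow> bit" where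
  "quad2 \<sigma> = lvl1 \<sigma> + quad1 (sec \<sigma> La) + quad1 (sec \<sigma> Lb)"

text \<open>The defining conditions at a node involve no parity at that node, so those at the root
  are conditions on the two sections.\<close>

definition root_cond :: "(node \<Rightarrow> node) \<Rightarrow> (node \<Rightarrow> node) \<Rightarrow> bool" where
  "root_cond g h \<longleftrightarrow> lvl2 g = lvl1 h \<and> lvl2 h = lvl1 g \<and> quad2 g + quad2 h = lvl1 g * lvl1 h"

lemma lvl1_sec: "\<sigma> \<in> Aut_T \<Longrightarrow> lvl1 \<sigma> = Par (sec \<sigma> La) [] + Par (sec \<sigma> Lb) []"
  by (simp add: lvl1_def Par_sec)

lemma lvl2_sec: "\<sigma> \<in> Aut_T \<Longrightarrow> lvl2 \<sigma> = lvl1 (sec \<sigma> La) + lvl1 (sec \<sigma> Lb)"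
  by (simp add: lvl1_def lvl2_def Par_sec add.assoc)

lemma quad1_sec: "\<sigma> \<in> Aut_T \<Longrightarrow> quad1 \<sigma> = Par (sec \<sigma> Lb) [] + lvl1 (sec \<sigma> La)"
  by (simp add: lvl1_def quad1_def Par_sec add.assoc)

lemma bit_add_eq_iff: "(x::bit) + y = z \<longleftrightarrow> x = y + z"
  by (cases x; cases y; cases z; simp)

lemma bit_add_eq_0_iff: "(x::bit) + y = 0 \<longleftrightarrow> x = y"
  by (simp add: bit_add_eq_iff)

lemma B32_tilde_eq:
  "B32_tilde = {\<sigma> \<in> Aut_T. \<forall>x. Pa32 \<sigma> x = 0 \<and> Pb32 \<sigma> x = 0 \<and> R32_at \<sigma> x = 0}"
proof -
  have P: "P32 \<sigma> = c" if "\<forall>x. Pa32 \<sigma> x = c \<and> Pb32 \<sigma> x = c" for \<sigma> c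
    unfolding P32_def using that by (intro the_equality) auto
  have R: "R32 \<sigma> = c" if "\<forall>x. R32_at \<sigma> x = c" for \<sigma> c
    unfolding R32_def using that by (intro the_equality) auto
  show ?thesis
    using P R by (auto simp: B32_tilde_def M32_tilde_def B32_def M32_def)
qed

lemma root_cond_iff:
  assumes "\<sigma> \<in> Aut_T"
  shows "root_cond (sec \<sigma> La) (sec \<sigma> Lb) \<longleftrightarrow>
    Pa32 \<sigma> [] = 0 \<and> Pb32 \<sigma> [] = 0 \<and> R32_at \<sigma> [] = 0"
proof -
  have "Pa32 \<sigma> [] = lvl2 (sec \<sigma> La) + lvl1 (sec \<sigma> Lb)" "Pb32 \<sigma> [] = lvl2 (sec \<sigma> Lb) + lvl1 (sec \<sigma> La)"
    unfolding Pa32_def Pb32_def sum_words2 sum_letters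
    by (simp_all add: lvl1_def lvl2_def Par_sec assms)
  moreover have "R32_at \<sigma> [] = quad2 (sec \<sigma> La) + quad2 (sec \<sigma> Lb) + lvl1 (sec \<sigma> La) * lvl1 (sec \<sigma> Lb)"
    unfolding R32_at_def sum_words2 sum_letters
    by (simp add: lvl1_def quad1_def quad2_def Par_sec sec_in_Aut_T assms algebra_simps)
  ultimately show ?thesis by (simp add: root_cond_def bit_add_eq_0_iff)
qed

lemma conditions_sec:
  assumes "\<sigma> \<in> Aut_T"
  shows "Pa32 (sec \<sigma> y) x = Pa32 \<sigma> (y # x)" "Pb32 (sec \<sigma> y) x = Pb32 \<sigma> (y # x)"
    "R32_at (sec \<sigma> y) x = R32_at \<sigma> (y # x)"
  unfolding Pa32_def Pb32_def R32_at_def by (simp_all add: Par_sec assms)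

lemma B32_tilde_Aut_T: "\<sigma> \<in> B32_tilde \<Longrightarrow> \<sigma> \<in> Aut_T"
  by (simp add: B32_tilde_eq)

lemma B32_tilde_iff:
  "\<sigma> \<in> B32_tilde \<longleftrightarrow> \<sigma> \<in> Aut_T \<and> root_cond (sec \<sigma> La) (sec \<sigma> Lb) \<and>
    sec \<sigma> La \<in> B32_tilde \<and> sec \<sigma> Lb \<in> B32_tilde"
proof (cases "\<sigma> \<in> Aut_T")
  case True
  have all: "(\<forall>x. Q x) \<longleftrightarrow> Q [] \<and> (\<forall>x. Q (La # x)) \<and> (\<forall>x. Q (Lb # x))" for Q :: "node \<Rightarrow> bool"
    by (metis letter.exhaust list.exhaust)
  show ?thesis
    unfolding B32_tilde_eq mem_Collect_eq root_cond_iff[OF True]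
    by (subst all) (auto simp: conditions_sec True sec_in_Aut_T)
qed (simp add: B32_tilde_eq)

text \<open>The conditions at \<open>y # x\<close> are those of the section
  \<open>sec \<sigma> y\<close> at \<open>x\<close>, so induction on the node reduces everything to
  the root. This suits self-similar elements such as \<open>alpha3\<close>.\<close>

lemma B32_tilde_coinduct:
  assumes "\<sigma> \<in> S"
    and S: "\<And>\<sigma>. \<sigma> \<in> S \<Longrightarrow> \<sigma> \<in> Aut_T \<and> root_cond (sec \<sigma> La) (sec \<sigma> Lb) \<and>
      (\<forall>y. sec \<sigma> y \<in> S)"
  shows "\<sigma> \<in> B32_tilde"
proof -
  have "Pa32 \<sigma> x = 0 \<and> Pb32 \<sigma> x = 0 \<and> R32_at \<sigma> x = 0" if "\<sigma> \<in> S" for \<sigma> x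
    using that
  proof (induction x arbitrary: \<sigma>)
    case Nil
    then show ?case using S root_cond_iff by blast
  next
    case (Cons y x)
    then show ?case using S conditions_sec by metis
  qed
  then show ?thesis using assms by (simp add: B32_tilde_eq)
qed

section \<open>The invariants under composition\<close>

lemma lvl1_comp:
  assumes "\<sigma> \<in> Aut_T" "\<tau> \<in> Aut_T"
  shows "lvl1 (\<sigma> \<circ> \<tau>) = lvl1 \<sigma> + lvl1 \<tau>"
  by (auto simp: lvl1_sec Par_comp sec_comp comp_in_Aut_T sec_in_Aut_T Aut_T_root[OF sec_in_Aut_T[OF assms(2)]]
      assms algebra_simps)

lemma lvl2_comp:
  assumes "\<sigma> \<in> Aut_T" "\<tau> \<in> Aut_T"
  shows "lvl2 (\<sigma> \<circ> \<tau>) = lvl2 \<sigma> + lvl2 \<tau>"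
  by (auto simp: lvl2_sec lvl1_comp comp_in_Aut_T sec_comp sec_in_Aut_T assms algebra_simps)

text \<open>A swap at the root of \<tau> exchanges the roles of the sections of \<sigma> in the
  asymmetric formula for \<open>quad1\<close>; the two versions differ by
  \<open>lvl1 \<sigma> + lvl2 \<sigma>\<close>.\<close>

lemma quad1_comp:
  assumes "\<sigma> \<in> Aut_T" "\<tau> \<in> Aut_T"
  shows "quad1 (\<sigma> \<circ> \<tau>) = quad1 \<sigma> + quad1 \<tau> + Par \<tau> [] * (lvl1 \<sigma> + lvl2 \<sigma>)"
  by (cases "Par \<tau> []")
    (auto simp: quad1_sec lvl1_sec[of \<sigma>] lvl2_sec[of \<sigma>] lvl1_comp Par_comp comp_in_Aut_T sec_comp
      Aut_T_root[OF sec_in_Aut_T[OF assms(2)]] sec_in_Aut_T assms algebra_simps)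

text \<open>Membership of \<sigma> gives both of its sections the same sum
  \<open>lvl1 + lvl2\<close>, namely \<open>lvl2 \<sigma>\<close>. The two corrections from
  \<open>quad1_comp\<close> thus share this factor, and the root parities of the sections of \<tau>
  add up to \<open>lvl1 \<tau>\<close>.\<close>

lemma quad2_comp:
  assumes \<sigma>: "\<sigma> \<in> B32_tilde" and \<tau>: "\<tau> \<in> Aut_T"
  shows "quad2 (\<sigma> \<circ> \<tau>) = quad2 \<sigma> + quad2 \<tau> + lvl1 \<tau> * lvl2 \<sigma>"
proof -
  have A: "\<sigma> \<in> Aut_T" using \<sigma> by (rule B32_tilde_Aut_T)
  have "lvl2 (sec \<sigma> La) = lvl1 (sec \<sigma> Lb)" "lvl2 (sec \<sigma> Lb) = lvl1 (sec \<sigma> La)"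
    using \<sigma> B32_tilde_iff[of \<sigma>] by (auto simp: root_cond_def)
  then show ?thesis
    by (auto simp: quad2_def quad1_comp lvl1_comp sec_comp sec_in_Aut_T A \<tau> lvl1_sec[OF \<tau>] lvl2_sec[OF A]
        algebra_simps)
qed

text \<open>By the level conditions, the corrections \<open>lvl1 g' * lvl2 g\<close> and
  \<open>lvl1 h' * lvl2 h\<close> are exactly the cross terms of the product
  \<open>(lvl1 g + lvl1 g') * (lvl1 h + lvl1 h')\<close>.\<close>

lemma root_cond_comp:
  assumes "root_cond g h" "root_cond g' h'" "g \<in> B32_tilde" "h \<in> B32_tilde"
    and "g' \<in> Aut_T" "h' \<in> Aut_T"
  shows "root_cond (g \<circ> g') (h \<circ> h')"
proof -
  have "quad2 g = quad2 h + lvl1 g * lvl1 h" "quad2 g' = quad2 h' + lvl1 g' * lvl1 h'"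
    using assms(1,2) by (auto simp: root_cond_def bit_add_eq_iff)
  then show ?thesis
    using assms
    by (simp add: root_cond_def lvl1_comp lvl2_comp quad2_comp B32_tilde_Aut_T algebra_simps)
qed

lemma root_cond_commute: "root_cond g h \<longleftrightarrow> root_cond h g"
  by (auto simp: root_cond_def algebra_simps)

lemma comp_in_B32_tilde:
  assumes "\<sigma> \<in> B32_tilde" "\<tau> \<in> B32_tilde"
  shows "\<sigma> \<circ> \<tau> \<in> B32_tilde"
proof (rule B32_tilde_coinduct[of _ "{\<sigma> \<circ> \<tau> | \<sigma> \<tau>. \<sigma> \<in> B32_tilde \<and> \<tau> \<in> B32_tilde}"])
  fix \<rho> assume "\<rho> \<in> {\<sigma> \<circ> \<tau> | \<sigma> \<tau>. \<sigma> \<in> B32_tilde \<and> \<tau> \<in> B32_tilde}"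
  then obtain \<sigma> \<tau> where \<rho>: "\<rho> = \<sigma> \<circ> \<tau>" and B: "\<sigma> \<in> B32_tilde" "\<tau> \<in> B32_tilde" by blast
  then have A: "\<sigma> \<in> Aut_T" "\<tau> \<in> Aut_T" by (auto simp: B32_tilde_Aut_T)
  have sB: "sec \<sigma> y \<in> B32_tilde" "sec \<tau> y \<in> B32_tilde" for y
    using B B32_tilde_iff by (metis letter.exhaust)+
  have "root_cond (sec \<sigma> La) (sec \<sigma> Lb)" "root_cond (sec \<tau> La) (sec \<tau> Lb)"
    using B B32_tilde_iff by blast+
  \<comment> \<open>If \<tau> swaps at the root, the sections of \<sigma> enter in exchanged order,
    which the symmetry of \<open>root_cond\<close> absorbs.\<close>
  then have "root_cond (sec \<rho> La) (sec \<rho> Lb)"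
    using sB A root_cond_commute
    by (auto simp: \<rho> sec_comp intro!: root_cond_comp intro: sec_in_Aut_T)
  then show "\<rho> \<in> Aut_T \<and> root_cond (sec \<rho> La) (sec \<rho> Lb) \<and>
    (\<forall>y. sec \<rho> y \<in> {\<sigma> \<circ> \<tau> | \<sigma> \<tau>. \<sigma> \<in> B32_tilde \<and> \<tau> \<in> B32_tilde})"
    using A sB by (auto simp: \<rho> sec_comp comp_in_Aut_T)
qed (use assms in blast)

section \<open>The generators\<close>

lemma alpha_in_Aut_T: "alpha1 \<in> Aut_T" "alpha2 \<in> Aut_T" "alpha3 \<in> Aut_T"
  by (simp_all add: alpha1_def alpha2_def alpha3_def aut_of_par_in_Aut_T)

lemma alpha_Nil: "alpha1 [] = []" "alpha2 [] = []" "alpha3 [] = []"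
  by (simp_all add: alpha1_def alpha2_def alpha3_def)

lemma sec_id: "sec id y = id"
  by (auto simp: sec_def)

lemma sec_alpha: "sec alpha1 y = id" "sec alpha2 La = alpha1" "sec alpha2 Lb = id"
  "sec alpha3 La = alpha2" "sec alpha3 Lb = alpha3"
  by (auto simp: sec_def alpha_rec)

lemma alpha_invariants:
  "Par alpha1 [] = 1" "lvl1 alpha1 = 0" "lvl2 alpha1 = 0" "quad1 alpha1 = 0" "quad2 alpha1 = 0"
  "Par alpha2 [] = 0" "lvl1 alpha2 = 1" "lvl2 alpha2 = 0" "quad1 alpha2 = 0" "quad2 alpha2 = 1"
  "Par alpha3 [] = 0" "lvl1 alpha3 = 0" "lvl2 alpha3 = 1" "quad1 alpha3 = 1" "quad2 alpha3 = 1"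
  "Par id [] = 0" "lvl1 id = 0" "lvl2 id = 0" "quad1 id = 0" "quad2 id = 0"
  by (simp_all add: Par_def lvl1_def lvl2_def quad1_def quad2_def sec_alpha sec_id alpha_rec alpha_Nil)

text \<open>Together with \<open>id\<close> the generators are closed under sections, as the
  coinduction requires.\<close>

lemma generators_in_B32_tilde:
  assumes "\<sigma> \<in> {id, alpha1, alpha2, alpha3}"
  shows "\<sigma> \<in> B32_tilde"
proof (rule B32_tilde_coinduct[OF assms])
  fix \<sigma> assume \<sigma>: "\<sigma> \<in> {id, alpha1, alpha2, alpha3}"
  have "sec \<sigma> y \<in> {id, alpha1, alpha2, alpha3}" for y
    using \<sigma> by (cases y) (auto simp: sec_alpha sec_id)
  with \<sigma> show "\<sigma> \<in> Aut_T \<and> root_cond (sec \<sigma> La) (sec \<sigma> Lb) \<and>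
    (\<forall>y. sec \<sigma> y \<in> {id, alpha1, alpha2, alpha3})"
    by (auto simp: alpha_in_Aut_T id_in_Aut_T root_cond_def sec_alpha sec_id alpha_invariants)
qed

lemma alpha_involution: "alpha1 \<circ> alpha1 = id" "alpha2 \<circ> alpha2 = id" "alpha3 \<circ> alpha3 = id"
proof -
  show 1: "alpha1 \<circ> alpha1 = id"
  proof
    fix w show "(alpha1 \<circ> alpha1) w = id w" by (cases w) (auto simp: alpha_rec alpha_Nil)
  qed
  show 2: "alpha2 \<circ> alpha2 = id"
  proof
    fix w show "(alpha2 \<circ> alpha2) w = id w"
    proof (cases w)
      case (Cons y v)
      then show ?thesis using fun_cong[OF 1, of v] by (cases y) (auto simp: alpha_rec)
    qed (simp add: alpha_Nil)
  qed
  show "alpha3 \<circ> alpha3 = id"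
  proof
    fix w show "(alpha3 \<circ> alpha3) w = id w"
    proof (induction w)
      case (Cons y v)
      then show ?case using fun_cong[OF 2, of v] by (cases y) (auto simp: alpha_rec)
    qed (simp add: alpha_Nil)
  qed
qed

section \<open>The discrete group\<close>

definition pink :: "(node \<Rightarrow> node) set" where
  "pink = generate Aut_T_group {alpha1, alpha2, alpha3}"

lemma Aut_T_group_simps:
  "carrier Aut_T_group = Aut_T" "\<one>\<^bsub>Aut_T_group\<^esub> = id"
  "\<sigma> \<in> Aut_T \<Longrightarrow> \<tau> \<in> Aut_T \<Longrightarrow> \<sigma> \<otimes>\<^bsub>Aut_T_group\<^esub> \<tau> = \<sigma> \<circ> \<tau>"
  by (auto simp: Aut_T_group_def BijGroup_def tree_aut_def compose_def)

lemma pink_subset: "pink \<subseteq> Aut_T"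
proof -
  interpret group Aut_T_group by (rule Aut_T_group_group)
  show ?thesis unfolding pink_def
    using generate_incl[of "{alpha1, alpha2, alpha3}"] by (simp add: Aut_T_group_simps alpha_in_Aut_T)
qed

lemma pink_id: "id \<in> pink"
  unfolding pink_def using generate.one[of Aut_T_group] by (simp add: Aut_T_group_simps)

lemma pink_alpha: "alpha1 \<in> pink" "alpha2 \<in> pink" "alpha3 \<in> pink"
  unfolding pink_def by (auto intro: generate.incl)

lemma pink_comp: "\<sigma> \<in> pink \<Longrightarrow> \<tau> \<in> pink \<Longrightarrow> \<sigma> \<circ> \<tau> \<in> pink"
  using generate.eng[of \<sigma> Aut_T_group "{alpha1, alpha2, alpha3}" \<tau>] pink_subset
  by (auto simp: Aut_T_group_simps pink_def subset_iff)

lemma pink_inverse: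
  assumes "\<sigma> \<in> pink"
  obtains \<tau> where "\<tau> \<in> pink" "\<sigma> \<circ> \<tau> = id" "\<tau> \<circ> \<sigma> = id"
proof -
  interpret group Aut_T_group by (rule Aut_T_group_group)
  have A: "\<sigma> \<in> carrier Aut_T_group" using assms pink_subset by (auto simp: Aut_T_group_simps)
  have "inv\<^bsub>Aut_T_group\<^esub> \<sigma> \<in> pink"
    using assms unfolding pink_def
    by (intro generate_m_inv_closed) (auto simp: Aut_T_group_simps alpha_in_Aut_T)
  then show ?thesis
    using that r_inv[OF A] l_inv[OF A] inv_closed[OF A] A
    by (simp add: Aut_T_group_simps)
qed

text \<open>The generators are involutions, so every element is a product of generators.\<close>

lemma pink_induct [consumes 1, case_names id alpha]:
  assumes "g \<in> pink" "P id"
    and step: "\<And>a g. a \<in> {alpha1, alpha2, alpha3} \<Longrightarrow> g \<in> pink \<Longrightarrow> P g \<Longrightarrow> P (a \<circ> g)"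
  shows "P g"
proof -
  interpret group Aut_T_group by (rule Aut_T_group_group)
  have inv_eq: "inv\<^bsub>Aut_T_group\<^esub> a = a" if "a \<in> {alpha1, alpha2, alpha3}" for a
    using that by (intro inv_equality) (auto simp: Aut_T_group_simps alpha_in_Aut_T alpha_involution)
  \<comment> \<open>The claim is strengthened to left multiplication by \<open>g\<close> preserving
    \<open>P\<close>, a property that passes to products.\<close>
  have "\<forall>h\<in>pink. P h \<longrightarrow> P (g \<circ> h)"
    using assms(1) unfolding pink_def
  proof (induction rule: generate.induct)
    case (eng g1 g2)
    then have "g1 \<in> pink" "g2 \<in> pink" by (simp_all add: pink_def)
    then have "g1 \<otimes>\<^bsub>Aut_T_group\<^esub> g2 = g1 \<circ> g2"
      using pink_subset by (intro Aut_T_group_simps(3)) auto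
    then show ?case
      using eng.IH pink_comp[OF \<open>g2 \<in> pink\<close>] by (metis pink_def comp_assoc)
  next
    case one
    show ?case by (simp only: Aut_T_group_simps id_comp) blast
  next
    case (incl a)
    then show ?case using step unfolding pink_def by blast
  next
    case (inv a)
    then show ?case using step unfolding pink_def inv_eq[OF inv] by blast
  qed
  then show ?thesis using pink_id assms(2) by (metis comp_id)
qed

lemma pink_subset_B32_tilde: "pink \<subseteq> B32_tilde"
proof
  fix g assume "g \<in> pink"
  then show "g \<in> B32_tilde"
  proof (induction rule: pink_induct)
    case (alpha a g)
    then have "a \<in> B32_tilde" by (intro generators_in_B32_tilde) simp
    then show ?case using alpha.IH by (rule comp_in_B32_tilde)
  qed (rule generators_in_B32_tilde, rule insertI1)
qed

section \<open>Pairs in the discrete group and the dihedral quotient\<close>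

lemma alpha_pair: "pair alpha1 id = alpha2" "pair id alpha1 = alpha1 \<circ> alpha2 \<circ> alpha1"
  "pair alpha2 alpha3 = alpha3" "pair alpha3 alpha2 = alpha1 \<circ> alpha3 \<circ> alpha1"
proof -
  have eqI: "pair g h = \<sigma>" if "\<sigma> [] = []" "\<And>w. \<sigma> (La # w) = La # g w" "\<And>w. \<sigma> (Lb # w) = Lb # h w"
    for g h \<sigma>
  proof
    fix w show "pair g h w = \<sigma> w"
    proof (cases w)
      case (Cons y v)
      then show ?thesis using that by (cases y) (auto simp: pair_def)
    qed (simp add: pair_def that)
  qed
  show "pair alpha1 id = alpha2" "pair id alpha1 = alpha1 \<circ> alpha2 \<circ> alpha1"
    "pair alpha2 alpha3 = alpha3" "pair alpha3 alpha2 = alpha1 \<circ> alpha3 \<circ> alpha1"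
    by (intro eqI; simp add: alpha_rec alpha_Nil)+
qed

lemma pair_alpha_in_pink: "pair alpha1 id \<in> pink" "pair id alpha1 \<in> pink"
  "pair alpha2 alpha3 \<in> pink" "pair alpha3 alpha2 \<in> pink"
  unfolding alpha_pair by (intro pink_comp pink_alpha)+

lemma alpha_cancel: "alpha1 \<circ> (alpha1 \<circ> g) = g" "alpha2 \<circ> (alpha2 \<circ> g) = g"
  "alpha3 \<circ> (alpha3 \<circ> g) = g"
  by (simp_all add: comp_assoc[symmetric] alpha_involution)

text \<open>\<open>alpha2\<close> and its conjugate by \<open>alpha1\<close> act on different
  subtrees and commute, which gives the same relation for \<open>alpha1\<close> and
  \<open>alpha2\<close>. It lifts through \<open>alpha2 = (alpha1, 1)\<close> and
  \<open>alpha3 = (alpha2, alpha3)\<close>, the second components cancelling.\<close>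

lemma alpha_dihedral: "alpha2 \<circ> (alpha3 \<circ> (alpha2 \<circ> alpha3)) = alpha3 \<circ> (alpha2 \<circ> (alpha3 \<circ> alpha2))"
proof -
  have 1: "alpha1 \<circ> (alpha2 \<circ> (alpha1 \<circ> alpha2)) = alpha2 \<circ> (alpha1 \<circ> (alpha2 \<circ> alpha1))"
    using pair_comp[of alpha1 id id alpha1] pair_comp[of id alpha1 alpha1 id]
    by (simp add: alpha_pair comp_assoc)
  have "pair alpha1 id \<circ> (pair alpha2 alpha3 \<circ> (pair alpha1 id \<circ> pair alpha2 alpha3)) =
    pair alpha2 alpha3 \<circ> (pair alpha1 id \<circ> (pair alpha2 alpha3 \<circ> pair alpha1 id))"
    by (simp only: pair_comp 1) (simp add: alpha_involution)
  then show ?thesis by (simp only: alpha_pair)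
qed

definition dihedral :: "(node \<Rightarrow> node) set" where
  "dihedral = {id, alpha2, alpha3, alpha2 \<circ> alpha3, alpha3 \<circ> alpha2, alpha2 \<circ> (alpha3 \<circ> alpha2),
    alpha3 \<circ> (alpha2 \<circ> alpha3), alpha2 \<circ> (alpha3 \<circ> (alpha2 \<circ> alpha3))}"

lemma dihedral_mult: "w \<in> dihedral \<Longrightarrow> alpha2 \<circ> w \<in> dihedral"
  "w \<in> dihedral \<Longrightarrow> alpha3 \<circ> w \<in> dihedral"
proof -
  show "w \<in> dihedral \<Longrightarrow> alpha2 \<circ> w \<in> dihedral"
    by (auto simp: dihedral_def alpha_cancel alpha_involution)
  show "w \<in> dihedral \<Longrightarrow> alpha3 \<circ> w \<in> dihedral"
    by (auto simp: dihedral_def alpha_cancel alpha_involution alpha_dihedral)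
qed

text \<open>The factor \<open>m\<close> plays the role of an element of the normal closure of
  \<open>alpha1\<close>; requiring \<open>pair id m \<in> pink\<close> is the form in which that is
  used later.\<close>

lemma pink_decompose:
  assumes "g \<in> pink"
  shows "\<exists>m w. g = m \<circ> w \<and> pair id m \<in> pink \<and> w \<in> dihedral"
  using assms
proof (induction rule: pink_induct)
  case id
  show ?case
    unfolding dihedral_def
    by (rule exI[of _ id], rule exI[of _ id]) (simp only: pair_id pink_id id_comp insertI1 simp_thms)
next
  case (alpha a g)
  then obtain m w where g: "g = m \<circ> w" "pair id m \<in> pink" "w \<in> dihedral" by blast
  consider "a = alpha1" | "a = alpha2" | "a = alpha3" using alpha by blast
  then show ?case
  proof cases
    case 1
    have "pair id (alpha1 \<circ> m) \<in> pink"
      using pink_comp[OF pair_alpha_in_pink(2) g(2)] by (simp add: pair_comp)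
    then show ?thesis using g 1 comp_assoc by metis
  next
    case 2
    \<comment> \<open>Conjugation by \<open>pair alpha3 alpha2\<close> conjugates \<open>m\<close>
      by \<open>alpha2\<close> and fixes the first component \<open>id\<close>.\<close>
    have "pair id (alpha2 \<circ> (m \<circ> alpha2)) \<in> pink"
      using pink_comp[OF pair_alpha_in_pink(4) pink_comp[OF g(2) pair_alpha_in_pink(4)]]
      by (simp add: pair_comp alpha_involution)
    moreover have "a \<circ> g = (alpha2 \<circ> (m \<circ> alpha2)) \<circ> (alpha2 \<circ> w)"
      by (simp add: 2 g comp_assoc alpha_cancel)
    ultimately show ?thesis using dihedral_mult g(3) by blast
  next
    case 3
    have "pair id (alpha3 \<circ> (m \<circ> alpha3)) \<in> pink"
      using pink_comp[OF pair_alpha_in_pink(3) pink_comp[OF g(2) pair_alpha_in_pink(3)]]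
      by (simp add: pair_comp alpha_involution)
    moreover have "a \<circ> g = (alpha3 \<circ> (m \<circ> alpha3)) \<circ> (alpha3 \<circ> w)"
      by (simp add: 3 g comp_assoc alpha_cancel)
    ultimately show ?thesis using dihedral_mult g(3) by blast
  qed
qed

lemma pink_section:
  assumes "g \<in> pink"
  shows "\<exists>k\<in>pink. pair g k \<in> pink"
  using assms
proof (induction rule: pink_induct)
  case id
  show ?case by (rule bexI[of _ id]) (simp_all only: pair_id pink_id)
next
  case (alpha a g)
  then obtain k where k: "k \<in> pink" "pair g k \<in> pink" by blast
  have "\<exists>b\<in>pink. pair a b \<in> pink"
    using alpha(1) pair_alpha_in_pink pink_alpha pink_id by blast
  then obtain b where "b \<in> pink" "pair a b \<in> pink" by blast
  then show ?case using k pink_comp pair_comp by metis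
qed

text \<open>The condition forces \<open>lvl1\<close>, \<open>lvl2\<close> and \<open>quad2\<close>
  of \<open>w\<close> to vanish, and on the listed words these three together detect the
  identity.\<close>

lemma dihedral_trivial:
  assumes "w \<in> dihedral" "root_cond id w"
  shows "w = id"
proof -
  have B: "alpha2 \<in> B32_tilde" "alpha3 \<in> B32_tilde" by (auto intro: generators_in_B32_tilde)
  have "lvl1 w = 0" "lvl2 w = 0" "quad2 w = 0"
    using assms(2) by (auto simp: root_cond_def alpha_invariants)
  then show ?thesis
    using assms(1)
    by (auto simp: dihedral_def lvl1_comp lvl2_comp quad2_comp comp_in_Aut_T alpha_in_Aut_T B
        alpha_invariants)
qed

text \<open>Multiplying by an element of \<open>pink\<close> whose first component inverts
  \<open>g\<close> reduces to first component \<open>id\<close>. There \<open>pink_decompose\<close>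
  splits off a factor in \<open>pink\<close>, and the dihedral remainder is trivial.\<close>

lemma pair_in_pink:
  assumes g: "g \<in> pink" and h: "h \<in> pink" and gh: "pair g h \<in> B32_tilde"
  shows "pair g h \<in> pink"
proof -
  have id_case: "pair id v \<in> pink" if v: "v \<in> pink" "pair id v \<in> B32_tilde" for v
  proof -
    obtain m w where w: "v = m \<circ> w" "pair id m \<in> pink" "w \<in> dihedral"
      using pink_decompose[OF v(1)] by blast
    have split: "pair id v = pair id m \<circ> pair id w" by (simp add: w pair_comp)
    obtain j where j: "j \<in> pink" "j \<circ> pair id m = id" using pink_inverse[OF w(2)] by metis
    have "pair id w = j \<circ> pair id v" by (simp add: split comp_assoc[symmetric] j)
    then have "pair id w \<in> B32_tilde"
      using comp_in_B32_tilde[OF _ v(2)] j(1) pink_subset_B32_tilde by auto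
    then have "root_cond id w" using B32_tilde_iff[of "pair id w"] by simp
    then have "w = id" using dihedral_trivial w(3) by blast
    then show ?thesis using w by simp
  qed
  obtain g' where g': "g' \<in> pink" "g' \<circ> g = id" using pink_inverse[OF g] by metis
  obtain k where k: "k \<in> pink" "pair g' k \<in> pink" using pink_section[OF g'(1)] by blast
  obtain j where j: "j \<in> pink" "j \<circ> pair g' k = id" using pink_inverse[OF k(2)] by metis
  have split: "pair g' k \<circ> pair g h = pair id (k \<circ> h)" by (simp add: pair_comp g')
  have "pair g' k \<circ> pair g h \<in> B32_tilde"
    using comp_in_B32_tilde[OF _ gh] k(2) pink_subset_B32_tilde by auto
  then have "pair id (k \<circ> h) \<in> pink"
    using id_case[OF pink_comp[OF k(1) h]] split by simp
  moreover have "pair g h = j \<circ> pair id (k \<circ> h)"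
    by (simp add: split[symmetric] comp_assoc[symmetric] j)
  ultimately show ?thesis using pink_comp[OF j(1)] by simp
qed

section \<open>Approximation by the discrete group\<close>

text \<open>All these invariants of an automorphism except its parity at the root are computable from those of
  its two sections; this is what lets the approximation go up one level.\<close>

definition same_invariants :: "(node \<Rightarrow> node) \<Rightarrow> (node \<Rightarrow> node) \<Rightarrow> bool" where
  "same_invariants \<sigma> \<tau> \<longleftrightarrow>
    Par \<sigma> [] = Par \<tau> [] \<and> lvl1 \<sigma> = lvl1 \<tau> \<and> lvl2 \<sigma> = lvl2 \<tau> \<and> quad1 \<sigma> = quad1 \<tau> \<and> quad2 \<sigma> = quad2 \<tau>"

text \<open>The three additive invariants are matched by a product of generators, then
  \<open>quad1\<close> and \<open>quad2\<close> are corrected in turn. The correcting factors stand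
  on the right, where their vanishing root parity and \<open>lvl1\<close> kill the cross
  terms.\<close>

lemma pink_invariants: "\<exists>g\<in>pink. same_invariants g \<sigma>"
proof -
  \<comment> \<open>\<open>?d\<close> and \<open>?c\<close> shift \<open>quad1\<close> and \<open>quad2\<close> respectively and nothing else.\<close>
  let ?d = "alpha2 \<circ> (alpha1 \<circ> (alpha2 \<circ> alpha1))"
  let ?c = "alpha2 \<circ> (alpha3 \<circ> (alpha2 \<circ> alpha3))"
  let ?I = "\<lambda>g. (Par g [], lvl1 g, lvl2 g, quad1 g, quad2 g)"
  note B = subsetD[OF pink_subset_B32_tilde]
  note A = subsetD[OF pink_subset]
  have comp: "?I (g \<circ> h) = (Par g [] + Par h [], lvl1 g + lvl1 h, lvl2 g + lvl2 h,
      quad1 g + quad1 h + Par h [] * (lvl1 g + lvl2 g), quad2 g + quad2 h + lvl1 h * lvl2 g)"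
    if "g \<in> pink" "h \<in> pink" for g h
    using that by (simp add: Par_comp lvl1_comp lvl2_comp quad1_comp quad2_comp A B Aut_T_root)
  have in_pink: "?c \<in> pink" "?d \<in> pink" by (intro pink_comp pink_alpha)+
  have c: "?I ?c = (0, 0, 0, 0, 1)" and d: "?I ?d = (0, 0, 0, 1, 0)"
    using comp by (simp_all add: pink_comp pink_alpha alpha_invariants)
  have other: "x + 1 = y" if "x \<noteq> y" for x y :: bit
    using that by (cases x; cases y) simp_all
  define opt where "opt e a = (if e = (1::bit) then a else id)" for e and a :: "node \<Rightarrow> node"
  have opt: "opt e a \<in> pink" if "a \<in> pink" for e a
    using that by (simp add: opt_def pink_id)
  have opt_alpha: "Par (opt e alpha1) [] = e" "lvl1 (opt e alpha1) = 0" "lvl2 (opt e alpha1) = 0"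
    "Par (opt e alpha2) [] = 0" "lvl1 (opt e alpha2) = e" "lvl2 (opt e alpha2) = 0"
    "Par (opt e alpha3) [] = 0" "lvl1 (opt e alpha3) = 0" "lvl2 (opt e alpha3) = e" for e
    by (cases e; simp add: opt_def alpha_invariants)+
  obtain u where u: "u \<in> pink" "Par u [] = Par \<sigma> []" "lvl1 u = lvl1 \<sigma>" "lvl2 u = lvl2 \<sigma>"
  proof
    let ?u = "opt (Par \<sigma> []) alpha1 \<circ> (opt (lvl1 \<sigma>) alpha2 \<circ> opt (lvl2 \<sigma>) alpha3)"
    show "?u \<in> pink" by (intro pink_comp opt pink_alpha)
    show "Par ?u [] = Par \<sigma> []" "lvl1 ?u = lvl1 \<sigma>" "lvl2 ?u = lvl2 \<sigma>"
      using comp[of "opt (Par \<sigma> []) alpha1" "opt (lvl1 \<sigma>) alpha2 \<circ> opt (lvl2 \<sigma>) alpha3"]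
        comp[of "opt (lvl1 \<sigma>) alpha2" "opt (lvl2 \<sigma>) alpha3"]
      by (simp_all add: opt pink_comp pink_alpha opt_alpha)
  qed
  obtain v where v: "v \<in> pink" "Par v [] = Par \<sigma> []" "lvl1 v = lvl1 \<sigma>" "lvl2 v = lvl2 \<sigma>" "quad1 v = quad1 \<sigma>"
  proof (cases "quad1 u = quad1 \<sigma>")
    case False
    have "?I (u \<circ> ?d) = (Par u [], lvl1 u, lvl2 u, quad1 u + 1, quad2 u)"
      using comp[OF u(1) in_pink(2)] d by simp
    then show ?thesis
      using u False pink_comp[OF u(1) in_pink(2)] by (intro that[of "u \<circ> ?d"]) (simp_all add: other)
  qed (use u that in blast)
  show ?thesis
  proof (cases "quad2 v = quad2 \<sigma>")
    case True
    then show ?thesis using v by (intro bexI[of _ v]) (simp_all add: same_invariants_def)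
  next
    case False
    have "?I (v \<circ> ?c) = (Par v [], lvl1 v, lvl2 v, quad1 v, quad2 v + 1)"
      using comp[OF v(1) in_pink(1)] c by simp
    then show ?thesis
      using v False pink_comp[OF v(1) in_pink(1)]
      by (intro bexI[of _ "v \<circ> ?c"]) (simp_all add: same_invariants_def other)
  qed
qed

text \<open>Agreement up to level \<open>n\<close> alone need not preserve \<open>root_cond\<close>,
  which looks at fixed depths. Carrying the invariants along transfers it from the sections of
  \<sigma> to \<open>g\<close> and \<open>h\<close>, so that \<open>pair_in_pink\<close>
  applies.\<close>

lemma pink_approximates:
  assumes "\<sigma> \<in> B32_tilde"
  shows "\<exists>g\<in>pink. same_invariants g \<sigma> \<and> (\<forall>w. length w \<le> n \<longrightarrow> g w = \<sigma> w)"
  using assms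
proof (induction n arbitrary: \<sigma>)
  case 0
  obtain g where "g \<in> pink" "same_invariants g \<sigma>" using pink_invariants by blast
  then show ?case
    using 0 pink_subset Aut_T_root[of g] Aut_T_root[of \<sigma>] B32_tilde_Aut_T by auto
next
  case (Suc n)
  have \<sigma>: "\<sigma> \<in> Aut_T" "root_cond (sec \<sigma> La) (sec \<sigma> Lb)"
    "sec \<sigma> La \<in> B32_tilde" "sec \<sigma> Lb \<in> B32_tilde"
    using Suc.prems B32_tilde_iff by blast+
  obtain g where g: "g \<in> pink" "same_invariants g (sec \<sigma> La)"
    "\<forall>w. length w \<le> n \<longrightarrow> g w = sec \<sigma> La w"
    using Suc.IH[OF \<sigma>(3)] by blast
  obtain h where h: "h \<in> pink" "same_invariants h (sec \<sigma> Lb)"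
    "\<forall>w. length w \<le> n \<longrightarrow> h w = sec \<sigma> Lb w"
    using Suc.IH[OF \<sigma>(4)] by blast
  have gh: "g \<in> B32_tilde" "h \<in> B32_tilde" using g(1) h(1) pink_subset_B32_tilde by auto
  then have ghA: "g \<in> Aut_T" "h \<in> Aut_T" by (auto simp: B32_tilde_Aut_T)
  have A: "pair g h \<in> Aut_T" by (rule pair_in_Aut_T[OF ghA])
  have "root_cond g h"
    using \<sigma>(2) g(2) h(2) by (simp add: root_cond_def same_invariants_def)
  then have "pair g h \<in> B32_tilde"
    using B32_tilde_iff[of "pair g h"] gh A by simp
  then have pink: "pair g h \<in> pink" by (rule pair_in_pink[OF g(1) h(1)])
  \<comment> \<open>Left multiplication by \<open>alpha1\<close> restores the root swap and leaves
    the sections unchanged.\<close>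
  define k where "k = (if Par \<sigma> [] = 1 then alpha1 \<circ> pair g h else pair g h)"
  have k: "k \<in> pink" using pink by (simp add: k_def pink_comp pink_alpha)
  then have kA: "k \<in> Aut_T" using pink_subset by blast
  have k0: "Par k [] = Par \<sigma> []"
    by (auto simp: k_def Par_comp alpha_in_Aut_T A ghA Aut_T_root alpha_invariants)
  have ksec: "sec k La = g" "sec k Lb = h"
    by (auto simp: k_def sec_comp alpha_in_Aut_T A sec_alpha)
  have "same_invariants k \<sigma>"
    using g(2) h(2)
    by (simp add: same_invariants_def quad2_def lvl1_sec lvl2_sec quad1_sec kA \<sigma>(1) k0 ksec)
  moreover have "k w = \<sigma> w" if "length w \<le> Suc n" for w
  proof (cases w)
    case Nil
    then show ?thesis by (simp add: Aut_T_root kA \<sigma>(1))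
  next
    case (Cons y v)
    then have "sec k y v = sec \<sigma> y v" using that g(3) h(3) by (cases y) (auto simp: ksec)
    then show ?thesis by (simp add: Cons Aut_T_Cons[OF kA] Aut_T_Cons[OF \<sigma>(1)] k0)
  qed
  ultimately show ?case using k by blast
qed

text \<open>The conditions at \<open>x\<close> read parities at most 4 levels below
  \<open>x\<close>, and each parity needs images one level further down. Hence they pass from
  \<open>pink\<close> to its closure.\<close>

lemma conditions_local:
  assumes "\<And>w. length w \<le> length x + 5 \<Longrightarrow> g w = \<sigma> w"
  shows "Pa32 g x = Pa32 \<sigma> x" "Pb32 g x = Pb32 \<sigma> x" "R32_at g x = R32_at \<sigma> x"
proof -
  have "Par g (x @ w) = Par \<sigma> (x @ w)" if "length w \<le> 4" for w
    using that assms by (simp add: Par_def)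
  then show "Pa32 g x = Pa32 \<sigma> x" "Pb32 g x = Pb32 \<sigma> x" "R32_at g x = R32_at \<sigma> x"
    by (simp_all add: Pa32_def Pb32_def R32_at_def words2_eq)
qed

theorem theorem6p5:
  shows "G32_Pink = B32_tilde"
proof -
  have G: "G32_Pink = {\<sigma> \<in> Aut_T. \<forall>n. \<exists>\<tau>\<in>pink. \<forall>w. length w \<le> n \<longrightarrow> \<tau> w = \<sigma> w}"
    unfolding G32_Pink_def pink_def[symmetric] by (rule Aut_T_closure[OF pink_subset])
  show ?thesis
  proof (intro subset_antisym subsetI)
    fix \<sigma> assume \<sigma>: "\<sigma> \<in> G32_Pink"
    have "Pa32 \<sigma> x = 0 \<and> Pb32 \<sigma> x = 0 \<and> R32_at \<sigma> x = 0" for x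
    proof -
      obtain g where g: "g \<in> pink" "\<forall>w. length w \<le> length x + 5 \<longrightarrow> g w = \<sigma> w"
        using \<sigma> unfolding G by blast
      then have "g \<in> B32_tilde" using pink_subset_B32_tilde by blast
      then show ?thesis using conditions_local[of x g \<sigma>] g(2) by (simp add: B32_tilde_eq)
    qed
    then show "\<sigma> \<in> B32_tilde" using \<sigma> by (simp add: B32_tilde_eq G)
  next
    fix \<sigma> assume "\<sigma> \<in> B32_tilde"
    then show "\<sigma> \<in> G32_Pink" using pink_approximates B32_tilde_Aut_T unfolding G by blast
  qed
qed

end
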